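(* Let $n$ be a positive integer with prime factorization $n=p_1^{\alpha_1}p_2^{\alpha_2}\cdots p_s^{\alpha_s}$. Then $$\sum_{x\mid n}Q_n[x]=\tau(n^2)=(2\alpha_1+1)(2\alpha_2+1)\cdots(2\alpha_s+1),$$ where the sum is over all positive divisors $x$ of $n$.
   Context: For positive integers $a,b$, $Q_a[b]$ denotes the number of positive integers $x$ with $\operatorname{lcm}(x,b)=a$. $\tau(n)$ is the number of positive divisors of $n$. *)

theory Defs
  imports "HOL-Computational_Algebra.Primes"
begin

(* Meant for positive a and b, where the set is finite (every x in it divides a).
   The positivity of x matters only for a = 0, since lcm 0 b = 0. *)
definition lcm_count :: "nat \<Rightarrow> nat \<Rightarrow> nat" where
  "lcm_count a b = card {x. 0 < x \<and> lcm x b = a}"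

definition tau :: "nat \<Rightarrow> nat" where
  "tau n = card {d. 0 < d \<and> d dvd n}"

end

theory Submission
  imports Defs
begin

text \<open>
  The sum counts the pairs \<open>(x, y)\<close> with \<open>lcm x y = n\<close>, grouped by \<open>x\<close>. These pairs
  correspond to the divisors of \<open>n\<^sup>2\<close>. At a prime with exponent \<open>a\<close> in \<open>n\<close>, the exponents
  \<open>(i, j)\<close> of \<open>x\<close> and \<open>y\<close> satisfy \<open>max i j = a\<close>, and \<open>i + (a - j)\<close> takes each value in
  \<open>{0..2a}\<close> exactly once: the values up to \<open>a\<close> come from \<open>j = a\<close>, those from \<open>a\<close> on from
  \<open>i = a\<close>. Globally this is the map sending \<open>(x, y)\<close> to \<open>d = x * (n div y)\<close>; with the
  complementary divisor \<open>e = n\<^sup>2 div d\<close>, its inverse is \<open>x = gcd d n\<close>, \<open>y = gcd e n\<close>.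
  Written this way, the bijection (\<open>card_lcm_pairs_eq_tau\<close>) follows from identities of gcd
  and lcm alone. The product formula is then the multiplicativity
  of \<open>tau\<close> applied to \<open>n\<^sup>2\<close>, in which all exponents are doubled.
\<close>

lemma finite_lcm_eq:
  assumes "n > 0"
  shows "finite {y :: nat. 0 < y \<and> lcm y x = n}"
proof (rule finite_subset)
  show "{y. 0 < y \<and> lcm y x = n} \<subseteq> {y. y dvd n}"
    by auto
  show "finite {y. y dvd n}"
    using assms by simp
qed

lemma sum_lcm_count_eq_card:
  assumes "n > 0"
  shows "(\<Sum>x | x > 0 \<and> x dvd n. lcm_count n x) = card {(x, y). lcm x y = n}"
proof -
  have "{(x, y). lcm x y = n} = (SIGMA x : {x. x > 0 \<and> x dvd n}. {y. 0 < y \<and> lcm y x = n})"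
    using assms by (auto simp: lcm.commute intro!: Nat.gr0I)
  then show ?thesis
    using assms by (simp add: lcm_count_def finite_lcm_eq)
qed

text \<open>
  Truncating two complementary divisors of \<open>n\<^sup>2\<close> at \<open>n\<close> yields a pair with lcm \<open>n\<close>. At each
  prime, two exponents with sum \<open>2a\<close> cannot both be less than \<open>a\<close>; the proof expresses this
  as \<open>n dvd lcm d e\<close>, obtained from \<open>gcd d e dvd n\<close> and \<open>gcd d e * lcm d e = n\<^sup>2\<close>.
\<close>

lemma lcm_gcd_gcd_complementary:
  fixes n d e :: nat
  assumes "n > 0" and de: "d * e = n ^ 2"
  shows "lcm (gcd d n) (gcd e n) = n"
proof -
  have "gcd d e ^ 2 dvd n ^ 2"
    using mult_dvd_mono[OF gcd_dvd1 gcd_dvd2, of d e d e] de by (simp add: power2_eq_square)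
  then have "gcd d e dvd n"
    by simp
  then obtain k where k: "n = gcd d e * k"
    by auto
  have "gcd d e * lcm d e = n * n"
    using de prod_gcd_lcm_nat[of d e] by (simp only: power2_eq_square)
  also have "\<dots> = gcd d e * (k * n)"
    by (subst (1) k) (rule mult.assoc)
  finally have "gcd d e * lcm d e = gcd d e * (k * n)" .
  moreover have "gcd d e > 0"
    using assms by (cases "d = 0") auto
  ultimately have "lcm d e = k * n"
    by (simp only: nat_mult_eq_cancel1)
  then have "n dvd lcm d e"
    by simp
  then have "gcd n (lcm d e) = n"
    by (simp add: gcd_nat.absorb1)
  then show ?thesis
    by (simp add: gcd_lcm_distrib gcd.commute)
qed

text \<open>
  Both sides equal \<open>gcd (n * n) (d * n)\<close>. Read as \<open>d = gcd d n * n / gcd e n\<close>, the equation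
  says that \<open>d\<close> is recovered from its pair of truncations.
\<close>

lemma mult_gcd_complementary:
  fixes n d e :: nat
  assumes "d * e = n ^ 2"
  shows "d * gcd e n = n * gcd d n"
  using assms gcd_mult_distrib_nat[of d e n] gcd_mult_distrib_nat[of n n d]
  by (simp only: power2_eq_square gcd.commute mult.commute)

text \<open>
  Conversely, \<open>x\<close> is recovered from \<open>x * (n div y)\<close>. Multiplying by \<open>y\<close> turns the claim into
  \<open>n * gcd x y = y * x\<close>, the relation between gcd and lcm.
\<close>

lemma gcd_mult_div_lcm:
  fixes x y :: nat
  assumes "lcm x y = n" and "n > 0"
  shows "gcd (x * (n div y)) n = x"
proof -
  have y: "y dvd n" "y > 0"
    using assms by (auto intro!: Nat.gr0I)
  have "y * gcd (x * (n div y)) n = gcd (n * x) (n * y)"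
    using y by (simp only: gcd_mult_distrib_nat mult.left_commute[of y x] dvd_mult_div_cancel
        mult.commute[of _ n])
  also have "\<dots> = n * gcd x y"
    by (simp only: gcd_mult_distrib_nat)
  also have "\<dots> = y * x"
    using prod_gcd_lcm_nat[of x y] assms by (simp add: mult.commute)
  finally show ?thesis
    using y by simp
qed

lemma card_lcm_pairs_eq_tau:
  assumes "n > 0"
  shows "card {(x, y). lcm x y = n} = tau (n ^ 2)"
proof -
  let ?D = "{d. 0 < d \<and> d dvd n ^ 2}"
  have "bij_betw (\<lambda>(x, y). x * (n div y)) {(x, y). lcm x y = n} ?D"
  proof (rule bij_betw_byWitness[where f' = "\<lambda>d. (gcd d n, gcd (n ^ 2 div d) n)"])
    \<comment> \<open>The complement of \<open>x * (n div y)\<close> in \<open>n\<^sup>2\<close> is the same expression with \<open>x\<close> and \<open>y\<close>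
      exchanged, so that \<open>gcd_mult_div_lcm\<close> recovers \<open>y\<close> as well as \<open>x\<close>.\<close>
    have lcm_pairs: "gcd (x * (n div y)) n = x \<and> n ^ 2 div (x * (n div y)) = y * (n div x)
        \<and> x * (n div y) > 0 \<and> x * (n div y) dvd n ^ 2"
      if "lcm x y = n" for x y
    proof -
      have xy: "x dvd n" "y dvd n" "x > 0" "y > 0"
        using that assms by (auto intro!: Nat.gr0I)
      have "x * (n div y) * (y * (n div x)) = (x * (n div x)) * (y * (n div y))"
        by (simp only: mult_ac)
      also have "\<dots> = n ^ 2"
        using xy by (simp add: power2_eq_square)
      finally have *: "x * (n div y) * (y * (n div x)) = n ^ 2" .
      then have pos: "x * (n div y) > 0"
        using assms by (metis gr0I mult_zero_left power_eq_0_iff)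
      show ?thesis
        using gcd_mult_div_lcm[OF that assms] pos
          nonzero_mult_div_cancel_left[of "x * (n div y)" "y * (n div x)"]
          dvd_triv_left[of "x * (n div y)" "y * (n div x)"]
        unfolding * by simp
    qed
    have gcd2: "gcd (y * (n div x)) n = y" if "lcm x y = n" for x y
      using gcd_mult_div_lcm[of y x n] that assms by (simp add: lcm.commute)
    show "\<forall>a\<in>{(x, y). lcm x y = n}. (\<lambda>d. (gcd d n, gcd (n\<^sup>2 div d) n)) ((\<lambda>(x, y). x * (n div y)) a) = a"
      using lcm_pairs gcd2 by auto
    show "(\<lambda>(x, y). x * (n div y)) ` {(x, y). lcm x y = n} \<subseteq> ?D"
      using lcm_pairs by auto
    show "\<forall>d\<in>?D. (\<lambda>(x, y). x * (n div y)) (gcd d n, gcd (n\<^sup>2 div d) n) = d"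
    proof
      fix d assume "d \<in> ?D"
      then have "d * (n ^ 2 div d) = n ^ 2"
        by simp
      from mult_gcd_complementary[OF this]
      have eq: "d * gcd (n ^ 2 div d) n = n * gcd d n" .
      let ?g = "gcd (n ^ 2 div d) n"
      have "?g * (gcd d n * (n div ?g)) = n * gcd d n"
        by (metis dvd_mult_div_cancel gcd_dvd2 mult.assoc mult.commute)
      then have "gcd d n * (n div ?g) = d"
        using eq assms by (metis gcd_pos_nat mult.commute mult_cancel2 not_gr_zero)
      then show "(\<lambda>(x, y). x * (n div y)) (gcd d n, ?g) = d"
        by simp
    qed
    show "(\<lambda>d. (gcd d n, gcd (n\<^sup>2 div d) n)) ` ?D \<subseteq> {(x, y). lcm x y = n}"
      using lcm_gcd_gcd_complementary[OF assms] by auto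
  qed
  then show ?thesis
    unfolding tau_def by (rule bij_betw_same_card)
qed

lemma tau_mult_coprime:
  assumes "coprime m k"
  shows "tau (m * k) = tau m * tau k"
proof -
  let ?D = "\<lambda>m. {d :: nat. 0 < d \<and> d dvd m}"
  have gcd_mult: "gcd (a * b) m = a \<and> gcd (a * b) k = b" if "a dvd m" "b dvd k" for a b
  proof -
    have "coprime a k"
      using coprime_divisors[OF that(1) dvd_refl assms] .
    moreover have "coprime b m"
      using coprime_divisors[OF dvd_refl that(2) assms] by (simp add: coprime_commute)
    ultimately have "gcd (a * b) m = gcd a m" "gcd (a * b) k = gcd b k"
      by (simp_all add: gcd_mult_left_left_cancel gcd_mult_left_right_cancel coprime_commute)
    then show ?thesis
      using that by (simp add: gcd_nat.absorb1)
  qed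
  have "bij_betw (\<lambda>(a, b). a * b) (?D m \<times> ?D k) (?D (m * k))"
  proof (rule bij_betw_imageI)
    show "inj_on (\<lambda>(a, b). a * b) (?D m \<times> ?D k)"
      by (rule inj_on_inverseI[where g = "\<lambda>d. (gcd d m, gcd d k)"]) (use gcd_mult in auto)
    show "(\<lambda>(a, b). a * b) ` (?D m \<times> ?D k) = ?D (m * k)"
    proof (intro equalityI subsetI)
      fix d assume d: "d \<in> ?D (m * k)"
      then obtain a b where "d = a * b" "a dvd m" "b dvd k"
        using division_decomp[of d m k] by blast
      with d show "d \<in> (\<lambda>(a, b). a * b) ` (?D m \<times> ?D k)"
        by (auto intro!: image_eqI[of _ _ "(a, b)"])
    qed (auto intro: mult_dvd_mono)
  qed
  from bij_betw_same_card[OF this] show ?thesis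
    by (simp add: tau_def card_cartesian_product)
qed

lemma tau_prime_power:
  assumes "prime p"
  shows "tau (p ^ k) = k + 1"
proof -
  have "{d. 0 < d \<and> d dvd p ^ k} = (\<lambda>i. p ^ i) ` {..k}"
    using assms by (auto simp: divides_primepow_nat le_imp_power_dvd prime_gt_0_nat)
  moreover have "inj_on (\<lambda>i. p ^ i) {..k}"
    using prime_gt_1_nat[OF assms] by (auto intro: inj_onI)
  ultimately show ?thesis
    by (simp add: tau_def card_image)
qed

lemma tau_prod_prime_powers:
  assumes "finite I" and "\<And>i. i \<in> I \<Longrightarrow> prime (p i)" and "inj_on p I"
  shows "tau (\<Prod>i\<in>I. p i ^ e i) = (\<Prod>i\<in>I. e i + 1)"
  using assms
proof (induction I rule: finite_induct)
  case empty
  show ?case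
    using tau_prime_power[OF two_is_prime_nat, of 0] by simp
next
  case (insert j I)
  have "coprime (p j) (p i)" if "i \<in> I" for i
    using insert that by (intro primes_coprime) auto
  then have "coprime (p j ^ e j) (\<Prod>i\<in>I. p i ^ e i)"
    by (intro prod_coprime_right) simp
  then show ?case
    using insert by (simp add: tau_mult_coprime tau_prime_power)
qed

theorem theorem9p13:
  fixes n s :: nat and p \<alpha> :: "nat \<Rightarrow> nat"
  assumes "n > 0"
    and "\<And>i. i \<in> {1..s} \<Longrightarrow> prime (p i)"
    and "inj_on p {1..s}"
    and "\<And>i. i \<in> {1..s} \<Longrightarrow> \<alpha> i > 0"
    and "n = (\<Prod>i = 1..s. p i ^ \<alpha> i)"
  shows "(\<Sum>x | x > 0 \<and> x dvd n. lcm_count n x) = tau (n ^ 2) \<and>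
         tau (n ^ 2) = (\<Prod>i = 1..s. (2 * \<alpha> i + 1))"
proof
  show "(\<Sum>x | x > 0 \<and> x dvd n. lcm_count n x) = tau (n ^ 2)"
    using assms(1) by (simp add: sum_lcm_count_eq_card card_lcm_pairs_eq_tau)
  have "n ^ 2 = (\<Prod>i = 1..s. p i ^ (2 * \<alpha> i))"
    unfolding assms(5) by (simp add: prod_power_distrib power_mult[symmetric] mult.commute)
  then show "tau (n ^ 2) = (\<Prod>i = 1..s. (2 * \<alpha> i + 1))"
    using tau_prod_prime_powers[of "{1..s}" p "\<lambda>i. 2 * \<alpha> i"] assms(2,3) by simp
qed

end
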